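(* Let $A$ be an $n\times n$ matrix in $\mathsf{TN}^{\mathrm{trop}}$, with tropical characteristic polynomial coefficients $a_0,\dots,a_n$. Then $a_k$ is active for all $k\in\{0,1,\dots,n\}$, and the tropical eigenvalues of $A$, counted with multiplicities, are precisely its diagonal entries.
   Context: $\mathbb{R}_{\max}=\mathbb{R}\cup\{-\infty\}$ with $a\oplus b=\max(a,b)$, $a\odot b=a+b$; tropical powers are $x^{\odot i}=ix$, with $(-\infty)^{\odot0}=0$. For a $d\times d$ matrix $M$ over $\mathbb{R}_{\max}$, $\operatorname{per}(M)=\max_{\sigma\in S_d}\sum_iM_{i,\sigma(i)}$; the weight of $\sigma$ is $\sum_iM_{i,\sigma(i)}$. $M$ is sign-nonsingular if $\operatorname{per}(M)\ne-\infty$ and all permutations of maximum weight have the same parity, and sign-singular otherwise. A tropical minor is the tropical permanent of a square submatrix (rows and columns in natural order); it is tropically nonnegative if either the submatrix is sign-singular or all its maximum-weight permutations are even. $\mathsf{TN}^{\mathrm{trop}}$ is the set of matrices over $\mathbb{R}_{\max}$ all of whose tropical minors are tropically nonnegative. The tropical characteristic polynomial of $A\in\mathbb{R}_{\max}^{n\times n}$ is the function $$f_A(x)=\operatorname{per}(x\odot I\oplus A)=x^{\odot n}\oplus\bigoplus_{i=0}^{n-1}a_{n-i}\odot x^{\odot i},$$ where $I$ is the tropical identity matrix ($0$ on the diagonal, $-\infty$ elsewhere), $a_0=0$, and $a_k$ is the maximum of the tropical permanents of all $k\times k$ principal submatrices of $A$. An element $\eta\in\mathbb{R}_{\max}$ is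 a tropical eigenvalue of $A$ if the maximum defining $f_A(\eta)$ is attained at least twice, i.e. there are $i\ne j$ with $f_A(\eta)=a_{n-i}\odot\eta^{\odot i}=a_{n-j}\odot\eta^{\odot j}$. The multiplicity of a tropical eigenvalue $\eta\ne-\infty$ is the difference between the right and left derivatives of $f_A$ at $\eta$; if $-\infty$ is a tropical eigenvalue, its multiplicity is the limit of the derivative of $f_A$ at $t$ as $t\to-\infty$. The coefficient $a_k$ is active if there exists a tropical eigenvalue $\eta$ such that $f_A(\eta)=a_k\odot\eta^{\odot(n-k)}$. *)

theory Defs
  imports
    "HOL-Analysis.Analysis"
    "HOL-Combinatorics.Permutations"
    "Jordan_Normal_Form.Matrix"
    "Jordan_Normal_Form.DL_Submatrix"
begin

text \<open>
  The max-plus semiring is the set of extended reals without \<open>\<infinity>\<close>: tropical addition is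
  \<^const>\<open>max\<close>, tropical multiplication is \<open>+\<close> (on this set, \<open>-\<infinity>\<close> is absorbing for \<open>+\<close>),
  tropical zero is \<open>-\<infinity>\<close> and tropical one is \<open>0\<close>.
\<close>

definition R_max :: "ereal set" where
  "R_max = {x. x \<noteq> \<infinity>}"

definition trop_pow :: "ereal \<Rightarrow> nat \<Rightarrow> ereal" where
  "trop_pow x i = ereal (real i) * x"

lemma trop_pow_MInf: "trop_pow (-\<infinity>) i = (if i = 0 then 0 else -\<infinity>)"
  by (simp add: trop_pow_def zero_ereal_def [symmetric])

definition perm_weight :: "ereal mat \<Rightarrow> (nat \<Rightarrow> nat) \<Rightarrow> ereal" where
  "perm_weight M \<sigma> = (\<Sum>i<dim_row M. M $$ (i, \<sigma> i))"

text \<open>The following notions are meaningful for square matrices only.\<close>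

definition trop_per :: "ereal mat \<Rightarrow> ereal" where
  "trop_per M = Max {perm_weight M \<sigma> |\<sigma>. \<sigma> permutes {..<dim_row M}}"

definition max_perms :: "ereal mat \<Rightarrow> (nat \<Rightarrow> nat) set" where
  "max_perms M = {\<sigma>. \<sigma> permutes {..<dim_row M} \<and> perm_weight M \<sigma> = trop_per M}"

definition sign_nonsingular :: "ereal mat \<Rightarrow> bool" where
  "sign_nonsingular M \<longleftrightarrow> trop_per M \<noteq> -\<infinity> \<and>
     (\<forall>\<sigma>\<in>max_perms M. \<forall>\<tau>\<in>max_perms M. evenperm \<sigma> = evenperm \<tau>)"

definition trop_nonneg_minor :: "ereal mat \<Rightarrow> bool" where
  "trop_nonneg_minor M \<longleftrightarrow> \<not> sign_nonsingular M \<or> (\<forall>\<sigma>\<in>max_perms M. evenperm \<sigma>)"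

text \<open>
  \<^const>\<open>submatrix\<close> keeps rows and columns in their natural order. The empty minor, which the
  definition does not exclude, is always tropically nonnegative.
\<close>

definition TN_trop :: "ereal mat set" where
  "TN_trop = {M. elements_mat M \<subseteq> R_max \<and>
     (\<forall>I J. I \<subseteq> {..<dim_row M} \<and> J \<subseteq> {..<dim_col M} \<and> card I = card J \<longrightarrow>
        trop_nonneg_minor (submatrix M I J))}"

definition trop_one_mat :: "nat \<Rightarrow> ereal mat" where
  "trop_one_mat n = mat n n (\<lambda>(i, j). if i = j then 0 else -\<infinity>)"

definition trop_charpoly :: "ereal mat \<Rightarrow> ereal \<Rightarrow> ereal" where
  "trop_charpoly A x = trop_per (mat (dim_row A) (dim_row A)
     (\<lambda>(i, j). max (x + trop_one_mat (dim_row A) $$ (i, j)) (A $$ (i, j))))"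

definition trop_coeff :: "ereal mat \<Rightarrow> nat \<Rightarrow> ereal" where
  "trop_coeff A k = Max {trop_per (submatrix A I I) |I. I \<subseteq> {..<dim_row A} \<and> card I = k}"

lemma trop_coeff_0: "trop_coeff A 0 = 0"
proof -
  have "I \<subseteq> {..<dim_row A} \<and> card I = 0 \<longleftrightarrow> I = {}" for I
    using finite_subset [OF _ finite_lessThan, of I] card_0_eq [of I] by (cases "I = {}") auto
  then have "{trop_per (submatrix A I I) |I. I \<subseteq> {..<dim_row A} \<and> card I = 0}
      = {trop_per (submatrix A {} {})}"
    by simp
  moreover have "trop_per (submatrix A {} {}) = 0"
    by (simp add: trop_per_def perm_weight_def dim_submatrix)
  ultimately show ?thesis by (simp add: trop_coeff_def)
qed

definition trop_eigenvalue :: "ereal mat \<Rightarrow> ereal \<Rightarrow> bool" where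
  "trop_eigenvalue A \<eta> \<longleftrightarrow> \<eta> \<in> R_max \<and>
     (\<exists>i\<le>dim_row A. \<exists>j\<le>dim_row A. i \<noteq> j \<and>
        trop_charpoly A \<eta> = trop_coeff A (dim_row A - i) + trop_pow \<eta> i \<and>
        trop_charpoly A \<eta> = trop_coeff A (dim_row A - j) + trop_pow \<eta> j)"

text \<open>
  The tropical characteristic polynomial as a real function; nothing is lost, as it takes finite
  values at real arguments when the entries of the matrix lie in \<^const>\<open>R_max\<close>.
\<close>

definition trop_charpoly_real :: "ereal mat \<Rightarrow> real \<Rightarrow> real" where
  "trop_charpoly_real A t = real_of_ereal (trop_charpoly A (ereal t))"

text \<open>
  A relation rather than a function, so that the existence of the derivatives and of the limit is
  part of the assertion that an eigenvalue has multiplicity \<open>m\<close>.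
\<close>

definition has_trop_multiplicity :: "ereal mat \<Rightarrow> ereal \<Rightarrow> real \<Rightarrow> bool" where
  "has_trop_multiplicity A \<eta> m \<longleftrightarrow>
     (if \<eta> = -\<infinity> then
        (\<forall>\<^sub>F t in at_bot. trop_charpoly_real A differentiable (at t)) \<and>
        (deriv (trop_charpoly_real A) \<longlongrightarrow> m) at_bot
      else
        (\<exists>r l. (trop_charpoly_real A has_real_derivative r) (at_right (real_of_ereal \<eta>)) \<and>
               (trop_charpoly_real A has_real_derivative l) (at_left (real_of_ereal \<eta>)) \<and>
               m = r - l))"

definition trop_active :: "ereal mat \<Rightarrow> nat \<Rightarrow> bool" where
  "trop_active A k \<longleftrightarrow> (\<exists>\<eta>. trop_eigenvalue A \<eta> \<and>
     trop_charpoly A \<eta> = trop_coeff A k + trop_pow \<eta> (dim_row A - k))"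

end

theory Submission
  imports Defs
begin

text \<open>
  Nonnegativity of the \<open>2 \<times> 2\<close> minors already decides everything: it says that the matrix is
  inverse Monge, that is, that uncrossing two entries never lowers their sum. Uncrossing an
  arbitrary permutation step by step ends at the identity, so the identity has maximum weight in
  every principal submatrix (\<open>inverse_monge_diag_max\<close>). With \<open>d\<^sub>i\<close> for the diagonal entries this has
  two consequences. The coefficient \<open>a\<^sub>k\<close> is the sum of the \<open>k\<close> largest \<open>d\<^sub>i\<close>, and
  \<open>f\<^sub>A(x) = (\<Sum>i. max x d\<^sub>i)\<close>: the points moved by a permutation contribute at most the diagonal
  entries of the submatrix that they span. So \<open>f\<^sub>A\<close> is the tropical product of the linear
  factors \<open>x \<oplus> d\<^sub>i\<close>.

  The term of index \<open>k\<close> attains \<open>f\<^sub>A(\<eta>)\<close> exactly when there is a set \<open>I\<close> of \<open>k\<close> indices such that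
  choosing \<open>d\<^sub>i\<close> for \<open>i \<in> I\<close> and \<open>\<eta>\<close> elsewhere realizes the sum of the maxima. If
  \<open>|{i. d\<^sub>i > \<eta>}| \<le> k \<le> |{i. d\<^sub>i \<ge> \<eta>}|\<close>, there is such a set. This makes every diagonal
  entry an eigenvalue, and it makes every \<open>a\<^sub>k\<close> active: take for \<open>\<eta>\<close> the \<open>k\<close>-th largest diagonal
  entry, or the largest one if \<open>k = 0\<close>. If \<open>\<eta>\<close> is not a diagonal entry, then the sum of the
  maxima is finite, so that \<open>I\<close> has to be \<open>{i. d\<^sub>i > \<eta>}\<close> and only one \<open>k\<close> is left. The multiplicities are read off from the sum of maxima: the slope of
  \<open>max t d\<^sub>i\<close> jumps from 0 to 1 at a finite \<open>d\<^sub>i\<close>, and it is 1 everywhere if \<open>d\<^sub>i = -\<infinity>\<close>.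
\<close>

section \<open>Inverse Monge matrices\<close>

definition inverse_monge :: "nat \<Rightarrow> (nat \<Rightarrow> nat \<Rightarrow> ereal) \<Rightarrow> bool" where
  "inverse_monge n a \<longleftrightarrow>
     (\<forall>i k j l. i < k \<and> k < n \<and> j < l \<and> l < n \<longrightarrow> a i l + a k j \<le> a i j + a k l)"

text \<open>
  The largest index \<open>b\<close> can be made a fixed point: if \<open>\<sigma> i = b\<close> with \<open>i \<noteq> b\<close>, then the entries in
  rows \<open>i\<close> and \<open>b\<close> cross, and exchanging their columns does not lower the weight.
\<close>

lemma inverse_monge_diag_max:
  assumes "inverse_monge n a" "S \<subseteq> {..<n}" "\<sigma> permutes S"
  shows "(\<Sum>i\<in>S. a i (\<sigma> i)) \<le> (\<Sum>i\<in>S. a i i)"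
proof -
  have "finite S" using assms(2) finite_subset by blast
  then show ?thesis using assms(2,3)
  proof (induction S arbitrary: \<sigma> rule: finite_linorder_max_induct)
    case empty
    then show ?case by simp
  next
    case (insert b S)
    have bS: "b \<notin> S" using insert.hyps by auto
    obtain i where i: "\<sigma> i = b" using permutes_surj[OF insert.prems(2)] by (metis surjD)
    define \<tau> where "\<tau> = \<sigma> \<circ> Transposition.transpose i b"
    have iS: "i \<in> insert b S"
      using i insert.prems(2) permutes_in_image by fastforce
    have \<tau>b: "\<tau> b = b" by (simp add: \<tau>_def i)
    have "\<tau> permutes insert b S"
      unfolding \<tau>_def by (intro permutes_compose permutes_swap_id iS insert.prems) auto
    then have \<tau>: "\<tau> permutes S"
      by (rule permutes_superset) (use \<tau>b in auto)
    have IH: "(\<Sum>i\<in>S. a i (\<tau> i)) \<le> (\<Sum>i\<in>S. a i i)"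
      using insert.IH \<tau> insert.prems(1) by auto
    have "(\<Sum>i\<in>insert b S. a i (\<sigma> i)) \<le> (\<Sum>i\<in>insert b S. a i (\<tau> i))"
    proof (cases "i = b")
      case True
      then show ?thesis by (simp add: \<tau>_def)
    next
      case False
      then have "i \<in> S" using iS by auto
      then have ib: "i < b" using insert.hyps by auto
      have "\<sigma> b \<noteq> b" using i False permutes_inj[OF insert.prems(2)] by (metis injD)
      moreover have "\<sigma> b \<in> insert b S" using permutes_in_image[OF insert.prems(2)] by simp
      ultimately have "\<sigma> b < b" using insert.hyps by auto
      then have cross: "a i b + a b (\<sigma> b) \<le> a i (\<sigma> b) + a b b"
        using assms(1) ib insert.prems(1) unfolding inverse_monge_def by blast
      have split: "(\<Sum>i\<in>insert b S. f i) = (f i + f b) + (\<Sum>i\<in>S - {i}. f i)" for f :: "nat \<Rightarrow> ereal"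
        using insert.hyps(1) bS \<open>i \<in> S\<close> by (simp add: sum.remove[of S i] ac_simps)
      have "(\<Sum>j\<in>S - {i}. a j (\<tau> j)) = (\<Sum>j\<in>S - {i}. a j (\<sigma> j))"
        by (rule sum.cong) (use bS in \<open>auto simp: \<tau>_def Transposition.transpose_def\<close>)
      moreover have "\<tau> i = \<sigma> b" by (simp add: \<tau>_def)
      ultimately have "(a i (\<sigma> i) + a b (\<sigma> b)) + (\<Sum>j\<in>S - {i}. a j (\<sigma> j))
          \<le> (a i (\<tau> i) + a b (\<tau> b)) + (\<Sum>j\<in>S - {i}. a j (\<tau> j))"
        unfolding i \<tau>b using cross add_right_mono by metis
      then show ?thesis by (simp only: split)
    qed
    also have "\<dots> \<le> (\<Sum>i\<in>insert b S. a i i)"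
      using insert.hyps(1) bS \<tau>b IH by (simp add: add_left_mono)
    finally show ?case .
  qed
qed

lemma pick_in_subset:
  assumes "I \<subseteq> {..<n}" "i < card I"
  shows "pick I i \<in> I" "pick I i < n"
proof -
  show "pick I i \<in> I" using assms(2) by (rule pick_in_set_le)
  then show "pick I i < n" using assms(1) by auto
qed

lemma submatrix_subset:
  assumes "A \<in> carrier_mat n m" "I \<subseteq> {..<n}" "J \<subseteq> {..<m}"
  shows "submatrix A I J = mat (card I) (card J) (\<lambda>(i, j). A $$ (pick I i, pick J j))"
proof -
  have "{i. i < n \<and> i \<in> I} = I" "{j. j < m \<and> j \<in> J} = J" using assms by auto
  then show ?thesis using assms(1) by (simp add: submatrix_def)
qed

lemma bij_betw_pick:
  assumes "finite I"
  shows "bij_betw (pick I) {..<card I} I"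
proof -
  have inj: "inj_on (pick I) {..<card I}"
    by (rule inj_onI) (metis lessThan_iff less_irrefl linorder_neqE_nat pick_mono_le)
  moreover have "pick I ` {..<card I} \<subseteq> I" using pick_in_set_le by auto
  then have "pick I ` {..<card I} = I"
    using assms inj by (simp add: card_image card_subset_eq)
  ultimately show ?thesis by (simp add: bij_betw_def)
qed

lemma pick_doubleton:
  assumes "i < (k::nat)"
  shows "pick {i, k} 0 = i" "pick {i, k} (Suc 0) = k"
proof -
  have "pick {i, k} 0 \<in> {i, k}" "pick {i, k} (Suc 0) \<in> {i, k}"
    "pick {i, k} 0 < pick {i, k} (Suc 0)"
    using assms by (intro pick_in_set_le pick_mono_le; simp)+
  moreover have "x = i \<and> y = k" if "x \<in> {i, k}" "y \<in> {i, k}" "x < y" for x y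
    using that assms by auto
  ultimately show "pick {i, k} 0 = i" "pick {i, k} (Suc 0) = k" by blast+
qed

lemma finite_perm_weights: "finite {perm_weight M \<sigma> |\<sigma>. \<sigma> permutes {..<dim_row M}}"
  using finite_permutations[of "{..<dim_row M}"] by (simp add: setcompr_eq_image)

lemma trop_per_eqI:
  assumes "\<And>\<sigma>. \<sigma> permutes {..<dim_row M} \<Longrightarrow> perm_weight M \<sigma> \<le> w"
    and "\<tau> permutes {..<dim_row M}" "perm_weight M \<tau> = w"
  shows "trop_per M = w"
  unfolding trop_per_def
  by (rule Max_eqI) (use assms finite_perm_weights in auto)

text \<open>
  If crossing entries had the larger sum, the transposition would be the only optimal permutation
  of the \<open>2 \<times> 2\<close> submatrix, and the minor would be tropically negative.
\<close>

lemma TN_trop_imp_inverse_monge: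
  assumes A: "A \<in> carrier_mat n n" and TN: "A \<in> TN_trop"
  shows "inverse_monge n (\<lambda>i j. A $$ (i, j))"
  unfolding inverse_monge_def
proof (intro allI impI)
  fix i k j l assume *: "i < k \<and> k < n \<and> j < l \<and> l < n"
  let ?B = "submatrix A {i, k} {j, l}" and ?t = "Transposition.transpose 0 (1::nat)"
  have "trop_nonneg_minor ?B"
    using TN A * unfolding TN_trop_def by auto
  have B: "?B = mat 2 2 (\<lambda>(p, q). A $$ (pick {i, k} p, pick {j, l} q))"
    using * by (subst submatrix_subset[OF A]) auto
  have row: "dim_row ?B = 2" and two: "{..<2} = {0, 1::nat}" by (auto simp: B)
  have ent: "?B $$ (0, 0) = A $$ (i, j)" "?B $$ (0, 1) = A $$ (i, l)"
    "?B $$ (1, 0) = A $$ (k, j)" "?B $$ (1, 1) = A $$ (k, l)"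
    using * by (simp_all add: B pick_doubleton del: pick.simps)
  have w_id: "perm_weight ?B id = A $$ (i, j) + A $$ (k, l)"
    and w_t: "perm_weight ?B ?t = A $$ (i, l) + A $$ (k, j)"
    unfolding perm_weight_def row two using ent by simp_all
  have perms: "\<sigma> permutes {..<dim_row ?B} \<longleftrightarrow> \<sigma> = id \<or> \<sigma> = ?t" for \<sigma>
    unfolding row two by (rule permutes_doubleton_iff)
  show "A $$ (i, l) + A $$ (k, j) \<le> A $$ (i, j) + A $$ (k, l)"
  proof (rule ccontr)
    assume "\<not> ?thesis"
    then have less: "perm_weight ?B id < perm_weight ?B ?t" unfolding w_id w_t by simp
    have per: "trop_per ?B = perm_weight ?B ?t"
      by (rule trop_per_eqI[where \<tau> = ?t]) (use less perms in auto)
    have max: "max_perms ?B = {?t}"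
      unfolding max_perms_def per perms using less by auto
    have "sign_nonsingular ?B"
      unfolding sign_nonsingular_def max per using less by auto
    moreover have "\<not> evenperm ?t" by (simp add: evenperm_swap)
    ultimately show False
      using \<open>trop_nonneg_minor ?B\<close> max by (simp add: trop_nonneg_minor_def)
  qed
qed

text \<open>
  The enumeration \<open>pick I\<close> of \<open>I\<close> is increasing, so principal submatrices inherit the inverse
  Monge property.
\<close>

lemma trop_per_principal:
  assumes A: "A \<in> carrier_mat n n" and monge: "inverse_monge n (\<lambda>i j. A $$ (i, j))"
    and I: "I \<subseteq> {..<n}"
  shows "trop_per (submatrix A I I) = (\<Sum>i\<in>I. A $$ (i, i))"
proof -
  let ?a = "\<lambda>p q. A $$ (pick I p, pick I q)"
  have fin: "finite I" using I finite_subset by blast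
  have B: "submatrix A I I = mat (card I) (card I) (\<lambda>(p, q). ?a p q)"
    using submatrix_subset[OF A I I] .
  have w: "perm_weight (submatrix A I I) \<sigma> = (\<Sum>p<card I. ?a p (\<sigma> p))"
    if "\<sigma> permutes {..<card I}" for \<sigma>
    unfolding perm_weight_def B
    by (rule sum.cong) (use permutes_in_image[OF that] in auto)
  have "inverse_monge (card I) ?a"
    using monge pick_mono_le[of _ I] pick_in_subset[OF I] unfolding inverse_monge_def by simp
  then have "perm_weight (submatrix A I I) \<sigma> \<le> (\<Sum>p<card I. ?a p p)"
    if "\<sigma> permutes {..<card I}" for \<sigma>
    using inverse_monge_diag_max[OF _ subset_refl that] w[OF that] by simp
  then have "trop_per (submatrix A I I) = (\<Sum>p<card I. ?a p p)"
    by (intro trop_per_eqI[where \<tau> = id]) (auto simp: B[THEN arg_cong, of dim_row] w permutes_id)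
  also have "\<dots> = (\<Sum>i\<in>I. A $$ (i, i))"
    using sum.reindex_bij_betw[OF bij_betw_pick[OF fin], of "\<lambda>i. A $$ (i, i)"] .
  finally show ?thesis .
qed

section \<open>The tropical characteristic polynomial\<close>

text \<open>
  The points moved by \<open>\<sigma>\<close> only see entries of \<open>A\<close>, which the diagonal dominates; a fixed point \<open>i\<close>
  contributes exactly \<open>max x d\<^sub>i\<close>.
\<close>

lemma trop_charpoly_inverse_monge:
  assumes A: "A \<in> carrier_mat n n" and monge: "inverse_monge n (\<lambda>i j. A $$ (i, j))"
    and x: "x \<noteq> \<infinity>"
  shows "trop_charpoly A x = (\<Sum>i<n. max x (A $$ (i, i)))"
proof -
  define M where "M = mat n n (\<lambda>(i, j). max (x + trop_one_mat n $$ (i, j)) (A $$ (i, j)))"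
  have ent: "M $$ (i, j) = (if i = j then max x (A $$ (i, i)) else A $$ (i, j))"
    if "i < n" "j < n" for i j
    using that x by (cases x) (auto simp: M_def trop_one_mat_def)
  have row: "dim_row M = n" by (simp add: M_def)
  have "perm_weight M \<sigma> \<le> (\<Sum>i<n. max x (A $$ (i, i)))" if \<sigma>: "\<sigma> permutes {..<n}" for \<sigma>
  proof -
    define S where "S = {i\<in>{..<n}. \<sigma> i \<noteq> i}"
    have S: "S \<subseteq> {..<n}" "\<sigma> permutes S"
      using permutes_superset[OF \<sigma>, of S] by (auto simp: S_def)
    have "perm_weight M \<sigma> = (\<Sum>i<n. if i \<in> S then A $$ (i, \<sigma> i) else max x (A $$ (i, i)))"
      unfolding perm_weight_def row
      by (rule sum.cong) (use permutes_in_image[OF \<sigma>] ent in \<open>auto simp: S_def\<close>)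
    also have "\<dots> = (\<Sum>i\<in>S. A $$ (i, \<sigma> i)) + (\<Sum>i\<in>{..<n} - S. max x (A $$ (i, i)))"
      using S(1) by (simp add: sum.If_cases Int_absorb1 Diff_eq)
    also have "\<dots> \<le> (\<Sum>i\<in>S. max x (A $$ (i, i))) + (\<Sum>i\<in>{..<n} - S. max x (A $$ (i, i)))"
      by (intro add_right_mono order_trans[OF inverse_monge_diag_max[OF monge S]] sum_mono) simp
    also have "\<dots> = (\<Sum>i<n. max x (A $$ (i, i)))"
      using S(1) by (simp add: sum.subset_diff[of S "{..<n}"] add.commute)
    finally show ?thesis .
  qed
  moreover have "perm_weight M id = (\<Sum>i<n. max x (A $$ (i, i)))"
    unfolding perm_weight_def row by (rule sum.cong) (auto simp: ent)
  ultimately have "trop_per M = (\<Sum>i<n. max x (A $$ (i, i)))"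
    by (intro trop_per_eqI[where \<tau> = id]) (auto simp: row permutes_id)
  then show ?thesis using A by (simp add: trop_charpoly_def M_def)
qed

lemma sum_const_trop_pow:
  assumes "finite S"
  shows "(\<Sum>i\<in>S. x) = trop_pow x (card S)"
  using assms
proof (induction S)
  case empty
  then show ?case by (simp add: trop_pow_def zero_ereal_def[symmetric])
next
  case (insert i S)
  have "ereal (1 + real m) * x = x + ereal (real m) * x" for m
    using ereal_left_distrib[of 1 "ereal (real m)" x] by (simp add: one_ereal_def)
  then show ?case using insert by (simp add: trop_pow_def)
qed

lemma sum_plus_trop_pow:
  assumes "I \<subseteq> {..<n}"
  shows "(\<Sum>i\<in>I. d i) + trop_pow \<eta> (n - card I) = (\<Sum>i<n. if i \<in> I then d i else \<eta>)"
proof -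
  have "(\<Sum>i<n. if i \<in> I then d i else \<eta>) = (\<Sum>i\<in>I. d i) + (\<Sum>i\<in>{..<n} - I. \<eta>)"
    using assms by (simp add: sum.If_cases Int_absorb1 Diff_eq)
  moreover have "card ({..<n} - I) = n - card I"
    using assms by (simp add: card_Diff_subset finite_subset)
  ultimately show ?thesis by (simp add: sum_const_trop_pow)
qed

text \<open>
  By \<open>trop_per_principal\<close>, the coefficient \<open>a\<^sub>k\<close> is the largest sum of \<open>k\<close> diagonal entries. Adding
  \<open>n - k\<close> copies of \<open>\<eta>\<close> gives a sum over all indices that picks one of \<open>\<eta>\<close> and \<open>d\<^sub>i\<close> for each \<open>i\<close>.
  Such a sum is bounded by \<open>f\<^sub>A(\<eta>)\<close> term by term, so one set \<open>I\<close> that reaches the bound suffices.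
\<close>

lemma trop_term_attained_iff:
  assumes A: "A \<in> carrier_mat n n" and monge: "inverse_monge n (\<lambda>i j. A $$ (i, j))"
    and \<eta>: "\<eta> \<noteq> \<infinity>" and k: "k \<le> n"
  shows "trop_charpoly A \<eta> = trop_coeff A k + trop_pow \<eta> (n - k) \<longleftrightarrow>
    (\<exists>I \<subseteq> {..<n}. card I = k \<and>
       (\<Sum>i<n. max \<eta> (A $$ (i, i))) = (\<Sum>i<n. if i \<in> I then A $$ (i, i) else \<eta>))"
    (is "?L \<longleftrightarrow> ?R")
proof -
  let ?d = "\<lambda>i. A $$ (i, i)" and ?C = "{I. I \<subseteq> {..<n} \<and> card I = k}"
  have "{trop_per (submatrix A I I) |I. I \<subseteq> {..<n} \<and> card I = k} = (\<lambda>I. sum ?d I) ` ?C"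
    unfolding setcompr_eq_image by (rule image_cong[OF refl]) (auto simp: trop_per_principal[OF A monge])
  then have coeff: "trop_coeff A k = Max ((\<lambda>I. sum ?d I) ` ?C)"
    using A by (simp add: trop_coeff_def)
  have fin: "finite ?C" by (rule finite_subset[of _ "Pow {..<n}"]) auto
  obtain I0 where "I0 \<subseteq> {..<n}" "card I0 = k"
    using obtain_subset_with_card_n[of k "{..<n}"] k by auto
  then have ne: "?C \<noteq> {}" by auto
  have "trop_coeff A k \<in> (\<lambda>I. sum ?d I) ` ?C"
    unfolding coeff by (rule Max_in) (use fin ne in simp_all)
  then obtain J where J: "J \<subseteq> {..<n}" "card J = k" "trop_coeff A k = sum ?d J"
    by auto
  have term_J: "trop_coeff A k + trop_pow \<eta> (n - k) = (\<Sum>i<n. if i \<in> J then ?d i else \<eta>)"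
    using sum_plus_trop_pow[OF J(1)] J by simp
  have f: "trop_charpoly A \<eta> = (\<Sum>i<n. max \<eta> (?d i))"
    using trop_charpoly_inverse_monge[OF A monge \<eta>] .
  show ?thesis
  proof
    assume ?L
    then show ?R using J term_J f by auto
  next
    assume ?R
    then obtain I where I: "I \<subseteq> {..<n}" "card I = k"
      "(\<Sum>i<n. max \<eta> (?d i)) = (\<Sum>i<n. if i \<in> I then ?d i else \<eta>)" by auto
    have "sum ?d I \<le> trop_coeff A k" unfolding coeff using I fin by auto
    then have "trop_charpoly A \<eta> \<le> trop_coeff A k + trop_pow \<eta> (n - k)"
      using sum_plus_trop_pow[OF I(1), of ?d \<eta>] I f by (metis add_right_mono)
    moreover have "trop_coeff A k + trop_pow \<eta> (n - k) \<le> trop_charpoly A \<eta>"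
      unfolding term_J f by (rule sum_mono) auto
    ultimately show ?L by (rule antisym)
  qed
qed

text \<open>
  A set \<open>I\<close> of \<open>k\<close> indices between \<open>{i. d\<^sub>i > \<eta>}\<close> and \<open>{i. d\<^sub>i \<ge> \<eta>}\<close> picks the larger of \<open>\<eta>\<close> and \<open>d\<^sub>i\<close>
  at every index. The converse fails at \<open>\<eta> = -\<infinity>\<close>, where both sides can be \<open>-\<infinity>\<close> for other \<open>k\<close>.
\<close>

lemma trop_term_attained_if_between:
  assumes A: "A \<in> carrier_mat n n" and monge: "inverse_monge n (\<lambda>i j. A $$ (i, j))"
    and \<eta>: "\<eta> \<noteq> \<infinity>"
    and "card {i\<in>{..<n}. \<eta> < A $$ (i, i)} \<le> k" "k \<le> card {i\<in>{..<n}. \<eta> \<le> A $$ (i, i)}"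
  shows "trop_charpoly A \<eta> = trop_coeff A k + trop_pow \<eta> (n - k)"
proof -
  have "{i\<in>{..<n}. \<eta> < A $$ (i, i)} \<subseteq> {i\<in>{..<n}. \<eta> \<le> A $$ (i, i)}" by auto
  then obtain I where I: "{i\<in>{..<n}. \<eta> < A $$ (i, i)} \<subseteq> I" "I \<subseteq> {i\<in>{..<n}. \<eta> \<le> A $$ (i, i)}"
    "card I = k"
    using exists_subset_between[OF assms(4,5)] by auto
  have "(\<Sum>i<n. max \<eta> (A $$ (i, i))) = (\<Sum>i<n. if i \<in> I then A $$ (i, i) else \<eta>)"
    by (rule sum.cong) (use I in \<open>auto simp: max_def\<close>)
  moreover have "I \<subseteq> {..<n}" using I by auto
  moreover from this have "k \<le> n" using I(3) card_mono[of "{..<n}" I] by simp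
  ultimately show ?thesis
    using trop_term_attained_iff[OF A monge \<eta>] I(3) by blast
qed

lemma sum_ereal_eq_imp_eq:
  fixes f g :: "'a \<Rightarrow> ereal"
  assumes "finite S" "\<And>i. i \<in> S \<Longrightarrow> f i \<le> g i" "\<And>i. i \<in> S \<Longrightarrow> \<bar>g i\<bar> \<noteq> \<infinity>"
    and "sum f S = sum g S" "i \<in> S"
  shows "f i = g i"
proof (rule ccontr)
  assume "f i \<noteq> g i"
  then have less: "f i < g i" using assms by (simp add: order.strict_iff_order)
  have "\<bar>sum g (S - {i})\<bar> \<noteq> \<infinity>" using assms(1,3) by (auto simp: sum_Inf)
  then have "f i + sum g (S - {i}) < g i + sum g (S - {i})"
    using ereal_less_add[OF _ less] add.commute by metis
  moreover have "f i + sum f (S - {i}) \<le> f i + sum g (S - {i})"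
    by (intro add_left_mono sum_mono) (use assms in auto)
  ultimately show False
    using assms(1,4,5) by (simp add: sum.remove[of S i])
qed

lemma trop_term_attained_off_diag:
  assumes A: "A \<in> carrier_mat n n" and monge: "inverse_monge n (\<lambda>i j. A $$ (i, j))"
    and fin: "\<And>i. i < n \<Longrightarrow> A $$ (i, i) \<noteq> \<infinity>"
    and \<eta>: "\<eta> \<noteq> \<infinity>" "\<And>i. i < n \<Longrightarrow> A $$ (i, i) \<noteq> \<eta>" and k: "k \<le> n"
    and att: "trop_charpoly A \<eta> = trop_coeff A k + trop_pow \<eta> (n - k)"
  shows "k = card {i\<in>{..<n}. \<eta> < A $$ (i, i)}"
proof -
  obtain I where I: "I \<subseteq> {..<n}" "card I = k"
    "(\<Sum>i<n. max \<eta> (A $$ (i, i))) = (\<Sum>i<n. if i \<in> I then A $$ (i, i) else \<eta>)"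
    using trop_term_attained_iff[OF A monge \<eta>(1) k] att by auto
  \<comment> \<open>Finite also at \<open>\<eta> = -\<infinity>\<close>: then no diagonal entry is \<open>-\<infinity>\<close>.\<close>
  have "\<bar>max \<eta> (A $$ (i, i))\<bar> \<noteq> \<infinity>" if "i < n" for i
    using fin[OF that] \<eta>(1) \<eta>(2)[OF that] by (cases \<eta>; cases "A $$ (i, i)") (auto simp: max_def)
  then have eq: "(if i \<in> I then A $$ (i, i) else \<eta>) = max \<eta> (A $$ (i, i))" if "i < n" for i
    using I(3) that
    by (intro sum_ereal_eq_imp_eq[where S = "{..<n}" and i = i
          and f = "\<lambda>i. if i \<in> I then A $$ (i, i) else \<eta>" and g = "\<lambda>i. max \<eta> (A $$ (i, i))"])
      (simp_all only: finite_lessThan lessThan_iff, auto)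
  have "i \<in> I \<longleftrightarrow> \<eta> < A $$ (i, i)" if "i < n" for i
    using eq[OF that] \<eta>(2)[OF that] by (auto simp: max_def split: if_splits)
  then have "I = {i\<in>{..<n}. \<eta> < A $$ (i, i)}" using I(1) by auto
  then show ?thesis using I(2) by simp
qed

section \<open>Eigenvalues and active coefficients\<close>

text \<open>
  At a diagonal entry \<open>\<eta>\<close>, the terms of index \<open>|{i. d\<^sub>i > \<eta>}|\<close> and \<open>|{i. d\<^sub>i \<ge> \<eta>}|\<close> both attain the
  maximum, and these indices differ.
\<close>

lemma trop_eigenvalue_iff_diag:
  assumes A: "A \<in> carrier_mat n n" and monge: "inverse_monge n (\<lambda>i j. A $$ (i, j))"
    and fin: "\<And>i. i < n \<Longrightarrow> A $$ (i, i) \<noteq> \<infinity>"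
  shows "trop_eigenvalue A \<eta> \<longleftrightarrow> (\<exists>i<n. A $$ (i, i) = \<eta>)"
proof
  assume "trop_eigenvalue A \<eta>"
  then obtain i j where ij: "\<eta> \<noteq> \<infinity>" "i \<le> n" "j \<le> n" "i \<noteq> j"
    "trop_charpoly A \<eta> = trop_coeff A (n - i) + trop_pow \<eta> i"
    "trop_charpoly A \<eta> = trop_coeff A (n - j) + trop_pow \<eta> j"
    using A unfolding trop_eigenvalue_def R_max_def by auto
  show "\<exists>i<n. A $$ (i, i) = \<eta>"
  proof (rule ccontr)
    assume "\<not> ?thesis"
    then have "\<And>i. i < n \<Longrightarrow> A $$ (i, i) \<noteq> \<eta>" by auto
    note unique = trop_term_attained_off_diag[OF A monge fin ij(1) this]
    have "n - i = n - j"
      using unique[of "n - i"] unique[of "n - j"] ij by simp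
    then show False using ij by simp
  qed
next
  assume "\<exists>i<n. A $$ (i, i) = \<eta>"
  then obtain m where m: "m < n" "A $$ (m, m) = \<eta>" by auto
  then have \<eta>: "\<eta> \<noteq> \<infinity>" using fin by auto
  let ?p = "card {i\<in>{..<n}. \<eta> < A $$ (i, i)}" and ?q = "card {i\<in>{..<n}. \<eta> \<le> A $$ (i, i)}"
  have "?p < ?q" by (rule psubset_card_mono) (use m in auto)
  moreover have "?q \<le> n" using card_mono[of "{..<n}" "{i\<in>{..<n}. \<eta> \<le> A $$ (i, i)}"] by auto
  ultimately have pq: "?p \<le> n" "?q \<le> n" "n - ?p \<noteq> n - ?q" "?p \<le> ?q" by auto
  have "trop_charpoly A \<eta> = trop_coeff A (n - (n - ?p)) + trop_pow \<eta> (n - ?p)"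
    unfolding diff_diff_cancel[OF pq(1)]
    by (rule trop_term_attained_if_between[OF A monge \<eta> order_refl pq(4)])
  moreover have "trop_charpoly A \<eta> = trop_coeff A (n - (n - ?q)) + trop_pow \<eta> (n - ?q)"
    unfolding diff_diff_cancel[OF pq(2)]
    by (rule trop_term_attained_if_between[OF A monge \<eta> pq(4) order_refl])
  ultimately have "\<exists>i\<le>n. \<exists>j\<le>n. i \<noteq> j \<and>
      trop_charpoly A \<eta> = trop_coeff A (n - i) + trop_pow \<eta> i \<and>
      trop_charpoly A \<eta> = trop_coeff A (n - j) + trop_pow \<eta> j"
    using pq(3) by (intro exI[of _ "n - ?p"] exI[of _ "n - ?q"] conjI diff_le_self)
  then show "trop_eigenvalue A \<eta>"
    unfolding trop_eigenvalue_def R_max_def mem_Collect_eq carrier_matD(1)[OF A]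
    using \<eta> by (rule conjI[rotated])
qed

text \<open>
  The \<open>k\<close>-th largest value, for \<open>k \<ge> 1\<close>, is the largest \<open>\<eta>\<close> among the values for which at least \<open>k\<close>
  indices satisfy \<open>d i \<ge> \<eta>\<close>; for \<open>k = 0\<close> this is the maximum.
\<close>

lemma exists_kth_largest:
  fixes d :: "nat \<Rightarrow> 'a::linorder"
  assumes "n \<ge> 1" "k \<le> n"
  shows "\<exists>m<n. card {i\<in>{..<n}. d m < d i} \<le> k \<and> k \<le> card {i\<in>{..<n}. d m \<le> d i}"
proof -
  define E where "E = {\<eta> \<in> d ` {..<n}. k \<le> card {i\<in>{..<n}. \<eta> \<le> d i}}"
  have fin: "finite E" by (simp add: E_def)
  have ne: "d ` {..<n} \<noteq> {}" using assms(1) by (auto simp: lessThan_empty_iff)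
  have "{i\<in>{..<n}. Min (d ` {..<n}) \<le> d i} = {..<n}" by auto
  then have "Min (d ` {..<n}) \<in> E"
    using assms(2) Min_in[OF _ ne] by (simp add: E_def)
  then have "Max E \<in> E" using fin by (intro Max_in) auto
  then obtain m where m: "m < n" "d m = Max E" "k \<le> card {i\<in>{..<n}. d m \<le> d i}"
    by (auto simp: E_def)
  have "card {i\<in>{..<n}. d m < d i} \<le> k"
  proof (cases "{i\<in>{..<n}. d m < d i} = {}")
    case True
    then show ?thesis by (simp only: card.empty)
  next
    case False
    let ?G = "{i\<in>{..<n}. d m < d i}"
    \<comment> \<open>The next larger value \<open>d j\<close> has upper set \<open>?G\<close>, and it is not in \<open>E\<close>.\<close>
    have "Min (d ` ?G) \<in> d ` ?G" by (rule Min_in) (use False in simp_all)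
    then obtain j where j: "Min (d ` ?G) = d j" "j \<in> ?G" by (rule imageE)
    have "d j \<le> d i" if "i \<in> ?G" for i
      unfolding j(1)[symmetric] by (intro Min_le imageI that) simp
    then have sub: "?G \<subseteq> {i\<in>{..<n}. d j \<le> d i}" by blast
    have "d j \<notin> E" using j(2) m(2) Max_ge[OF fin, of "d j"] by fastforce
    then have "card {i\<in>{..<n}. d j \<le> d i} < k" using j(2) by (simp add: E_def)
    moreover have "card ?G \<le> card {i\<in>{..<n}. d j \<le> d i}" by (rule card_mono[OF _ sub]) simp
    ultimately show ?thesis by linarith
  qed
  then show ?thesis using m by auto
qed

lemma trop_active_all:
  assumes A: "A \<in> carrier_mat n n" and monge: "inverse_monge n (\<lambda>i j. A $$ (i, j))"
    and fin: "\<And>i. i < n \<Longrightarrow> A $$ (i, i) \<noteq> \<infinity>" and "n \<ge> 1" "k \<le> n"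
  shows "trop_active A k"
proof -
  obtain m where m: "m < n" "card {i\<in>{..<n}. A $$ (m, m) < A $$ (i, i)} \<le> k"
    "k \<le> card {i\<in>{..<n}. A $$ (m, m) \<le> A $$ (i, i)}"
    using exists_kth_largest[OF assms(4,5), of "\<lambda>i. A $$ (i, i)"] by auto
  have "trop_eigenvalue A (A $$ (m, m))"
    using trop_eigenvalue_iff_diag[OF A monge fin] m(1) by auto
  then show ?thesis
    using trop_term_attained_if_between[OF A monge fin[OF m(1)] m(2,3)]
    unfolding trop_active_def carrier_matD(1)[OF A] by blast
qed

section \<open>Multiplicities\<close>

text \<open>
  The two one-sided slopes differ at \<open>x = d\<close> only. The punctured filters are reached through the
  closed half lines \<open>{x..}\<close> and \<open>{..x}\<close>, because replacing a function by another one near \<open>x\<close>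
  requires \<open>x\<close> to lie in the set.
\<close>

lemma has_derivative_max_right:
  assumes "d \<noteq> \<infinity>"
  shows "((\<lambda>t. real_of_ereal (max (ereal t) d)) has_real_derivative
           (if d \<le> ereal x then 1 else 0)) (at_right x)"
proof (cases d)
  case (real r)
  have eq: "(\<lambda>t. real_of_ereal (max (ereal t) d)) = (\<lambda>t. max t r)"
    using real by (auto simp: max_def)
  show ?thesis
  proof (cases "r \<le> x")
    case True
    have "((\<lambda>t. max t r) has_real_derivative 1) (at x within {x..})"
      by (rule has_field_derivative_transform_within[where f = "\<lambda>t. t" and d = 1])
        (use True in \<open>auto simp: max_def\<close>)
    then have "((\<lambda>t. max t r) has_real_derivative 1) (at_right x)"
      by (rule DERIV_subset) auto
    then show ?thesis using True real eq by simp
  next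
    case False
    have "((\<lambda>t. max t r) has_real_derivative 0) (at x within {x..})"
      by (rule has_field_derivative_transform_within[where f = "\<lambda>t. r" and d = "r - x"])
        (use False in \<open>auto simp: max_def dist_real_def\<close>)
    then have "((\<lambda>t. max t r) has_real_derivative 0) (at_right x)"
      by (rule DERIV_subset) auto
    then show ?thesis using False real eq by simp
  qed
qed (use assms in \<open>auto intro!: derivative_eq_intros\<close>)

lemma has_derivative_max_left:
  assumes "d \<noteq> \<infinity>"
  shows "((\<lambda>t. real_of_ereal (max (ereal t) d)) has_real_derivative
           (if d < ereal x then 1 else 0)) (at_left x)"
proof (cases d)
  case (real r)
  have eq: "(\<lambda>t. real_of_ereal (max (ereal t) d)) = (\<lambda>t. max t r)"
    using real by (auto simp: max_def)
  show ?thesis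
  proof (cases "r < x")
    case True
    have "((\<lambda>t. max t r) has_real_derivative 1) (at x within {..x})"
      by (rule has_field_derivative_transform_within[where f = "\<lambda>t. t" and d = "x - r"])
        (use True in \<open>auto simp: max_def dist_real_def\<close>)
    then have "((\<lambda>t. max t r) has_real_derivative 1) (at_left x)"
      by (rule DERIV_subset) auto
    then show ?thesis using True real eq by simp
  next
    case False
    have "((\<lambda>t. max t r) has_real_derivative 0) (at x within {..x})"
      by (rule has_field_derivative_transform_within[where f = "\<lambda>t. r" and d = 1])
        (use False in \<open>auto simp: max_def\<close>)
    then have "((\<lambda>t. max t r) has_real_derivative 0) (at_left x)"
      by (rule DERIV_subset) auto
    then show ?thesis using False real eq by simp
  qed
qed (use assms in \<open>auto intro!: derivative_eq_intros\<close>)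

lemma eventually_has_derivative_max:
  assumes "d \<noteq> \<infinity>"
  shows "\<forall>\<^sub>F x in at_bot. ((\<lambda>t. real_of_ereal (max (ereal t) d)) has_real_derivative
           (if d = -\<infinity> then 1 else 0)) (at x)"
proof (cases d)
  case (real r)
  have eq: "(\<lambda>t. real_of_ereal (max (ereal t) d)) = (\<lambda>t. max t r)"
    using real by (auto simp: max_def)
  have "((\<lambda>t. max t r) has_real_derivative 0) (at x)" if "x < r" for x
    by (rule has_field_derivative_transform_within[where f = "\<lambda>t. r" and d = "r - x"])
      (use that in \<open>auto intro!: derivative_eq_intros simp: max_def dist_real_def\<close>)
  then show ?thesis
    unfolding eq using real by (simp add: eventually_mono[OF eventually_gt_at_bot[of r]])
qed (use assms in \<open>auto intro!: derivative_eq_intros\<close>)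

lemma sum_indicator_card:
  fixes n :: nat
  shows "(\<Sum>i<n. if P i then 1 else 0) = real (card {i\<in>{..<n}. P i})"
  using sum.inter_filter[of "{..<n}" "\<lambda>_. 1::real" P] by simp

text \<open>
  The slopes of \<open>f\<^sub>A\<close> count indices: \<open>{i. d\<^sub>i \<le> \<eta>}\<close> to the right of \<open>\<eta>\<close>, \<open>{i. d\<^sub>i < \<eta>}\<close> to its left, and
  \<open>{i. d\<^sub>i = -\<infinity>}\<close> near \<open>-\<infinity>\<close>.
\<close>

lemma has_trop_multiplicity_inverse_monge:
  assumes A: "A \<in> carrier_mat n n" and monge: "inverse_monge n (\<lambda>i j. A $$ (i, j))"
    and fin: "\<And>i. i < n \<Longrightarrow> A $$ (i, i) \<noteq> \<infinity>" and \<eta>: "\<eta> \<noteq> \<infinity>"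
  shows "has_trop_multiplicity A \<eta> (real (card {i\<in>{..<n}. A $$ (i, i) = \<eta>}))"
proof -
  let ?d = "\<lambda>i. A $$ (i, i)"
  let ?g = "\<lambda>t i. real_of_ereal (max (ereal t) (?d i))"
  have "\<bar>max (ereal t) (?d i)\<bar> \<noteq> \<infinity>" if "i < n" for t i
    using fin[OF that] by (cases "?d i") (auto simp: max_def)
  then have f: "trop_charpoly_real A = (\<lambda>t. \<Sum>i<n. ?g t i)"
    unfolding trop_charpoly_real_def
    by (intro ext) (subst trop_charpoly_inverse_monge[OF A monge], simp, rule sum_real_of_ereal[symmetric], simp)
  show ?thesis
  proof (cases "\<eta> = -\<infinity>")
    case True
    let ?m = "real (card {i\<in>{..<n}. ?d i = -\<infinity>})"
    have "\<forall>\<^sub>F t in at_bot. \<forall>i\<in>{..<n}.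
        ((\<lambda>t. ?g t i) has_real_derivative (if ?d i = -\<infinity> then 1 else 0)) (at t)"
      by (intro eventually_ball_finite ballI eventually_has_derivative_max) (simp_all add: fin)
    then have ev: "\<forall>\<^sub>F t in at_bot. (trop_charpoly_real A has_real_derivative ?m) (at t)"
    proof eventually_elim
      case (elim t)
      then show ?case unfolding f sum_indicator_card[symmetric] by (intro DERIV_sum) auto
    qed
    then have "\<forall>\<^sub>F t in at_bot. trop_charpoly_real A differentiable (at t)"
      by (rule eventually_mono) (auto simp: real_differentiable_def)
    moreover have "\<forall>\<^sub>F t in at_bot. deriv (trop_charpoly_real A) t = ?m"
      using ev by (rule eventually_mono) (rule DERIV_imp_deriv)
    then have "(deriv (trop_charpoly_real A) \<longlongrightarrow> ?m) at_bot"
      by (rule tendsto_eventually)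
    ultimately show ?thesis using True by (simp add: has_trop_multiplicity_def)
  next
    case False
    then obtain x where x: "\<eta> = ereal x" using \<eta> by (cases \<eta>) auto
    let ?R = "{i\<in>{..<n}. ?d i \<le> ereal x}" and ?L = "{i\<in>{..<n}. ?d i < ereal x}"
      and ?E = "{i\<in>{..<n}. ?d i = ereal x}"
    have "(trop_charpoly_real A has_real_derivative real (card ?R)) (at_right x)"
      unfolding f sum_indicator_card[symmetric]
      by (intro DERIV_sum has_derivative_max_right) (simp_all add: fin)
    moreover have "(trop_charpoly_real A has_real_derivative real (card ?L)) (at_left x)"
      unfolding f sum_indicator_card[symmetric]
      by (intro DERIV_sum has_derivative_max_left) (simp_all add: fin)
    moreover have "?R = ?E \<union> ?L" by auto
    then have "card ?R = card ?E + card ?L"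
      by (simp add: card_Un_disjoint disjoint_iff)
    ultimately show ?thesis
      using x unfolding has_trop_multiplicity_def by (auto intro!: exI)
  qed
qed

section \<open>Totally nonnegative matrices\<close>

theorem proposition6p3:
  fixes A :: "ereal mat" and n :: nat
  assumes "n \<ge> 1"
    and "A \<in> carrier_mat n n"
    and "A \<in> TN_trop"
  shows "(\<forall>k\<in>{0..n}. trop_active A k) \<and>
    {\<eta>. trop_eigenvalue A \<eta>} = set (diag_mat A) \<and>
    (\<forall>\<eta>. trop_eigenvalue A \<eta> \<longrightarrow>
       has_trop_multiplicity A \<eta> (real (count_list (diag_mat A) \<eta>)))"
proof (intro conjI ballI allI impI)
  note A = assms(2)
  have monge: "inverse_monge n (\<lambda>i j. A $$ (i, j))"
    using TN_trop_imp_inverse_monge[OF A assms(3)] .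
  have fin: "A $$ (i, i) \<noteq> \<infinity>" if "i < n" for i
    using assms(3) A that unfolding TN_trop_def elements_mat_def R_max_def by fastforce
  note eig = trop_eigenvalue_iff_diag[OF A monge fin]
  show "trop_active A k" if "k \<in> {0..n}" for k
    using trop_active_all[OF A monge fin assms(1)] that by simp
  show "{\<eta>. trop_eigenvalue A \<eta>} = set (diag_mat A)"
    using A by (auto simp: eig diag_mat_def)
  fix \<eta> assume "trop_eigenvalue A \<eta>"
  then have "\<eta> \<noteq> \<infinity>" by (simp add: trop_eigenvalue_def R_max_def)
  moreover have "count_list (diag_mat A) \<eta> = card {i\<in>{..<n}. A $$ (i, i) = \<eta>}"
  proof -
    have "{i. i < length (diag_mat A) \<and> \<eta> = diag_mat A ! i} = {i\<in>{..<n}. A $$ (i, i) = \<eta>}"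
      using A by (auto simp: diag_mat_def)
    then show ?thesis
      unfolding count_list_eq_length_filter length_filter_conv_card by (rule arg_cong)
  qed
  ultimately show "has_trop_multiplicity A \<eta> (real (count_list (diag_mat A) \<eta>))"
    using has_trop_multiplicity_inverse_monge[OF A monge fin] by simp
qed

end
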